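(* Let $A\in\mathbb{R}^{m\times n}$, and let $F$, $S$ and $\Phi$ be the objects associated with $A$ as defined in the context. Then for any point $(x,y)\in(\Delta_m\times\Delta_n)\setminus S$, the exact regularity bound of $\Phi$ around $((x,y),F(x,y))$ admits the representation $$\operatorname{reg}\Phi\big((x,y),F(x,y)\big)=\frac{1}{\operatorname{dist}\big(0;\,\partial F(x,y)+N_{\Delta_m\times\Delta_n}(x,y)\big)},$$ where $\partial F(x,y)$ is the subdifferential (in the sense of convex analysis) of the convex function $F:\mathbb{R}^{m+n}\to\mathbb{R}$ at $(x,y)$ and $N_{\Delta_m\times\Delta_n}(x,y)$ is the normal cone (in the sense of convex analysis) to the convex set $\Delta_m\times\Delta_n$ at $(x,y)$.
   Context: All norms are Euclidean and $\operatorname{dist}(\cdot\,;C)$ is the Euclidean distance to a set $C$, with $\operatorname{dist}(\cdot\,;\emptyset)=\infty$ (convention $\inf\emptyset=\infty$). $\Delta_m=\{x\in\mathbb{R}^m : \sum_{i=1}^m x_i=1,\ x\ge 0\}$, and similarly $\Delta_n\subset\mathbb{R}^n$. For $(x,y)\in\mathbb{R}^m\times\mathbb{R}^n$ let $$F(x,y):=\max\{x^{T}Av-u^{T}Ay : (u,v)\in\Delta_m\times\Delta_n\}.$$ One has $\min_{\Delta_m\times\Delta_n}F=0$. Let $S:=\{(x,y)\in\Delta_m\times\Delta_n : F(x,y)=0\}$. The set-valued mapping $\Phi:\mathbb{R}^{m+n}\rightrightarrows\mathbb{R}$ is defined by $\Phi(x,y):=[F(x,y),\infty)$ if $(x,y)\in\Delta_m\times\Delta_n$,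 and $\Phi(x,y):=\emptyset$ otherwise. Metric regularity: for a set-valued mapping $G:\mathbb{R}^p\rightrightarrows\mathbb{R}^q$ with inverse $G^{-1}(z)=\{x : z\in G(x)\}$ and a point $(\bar x,\bar z)$ with $\bar z\in G(\bar x)$, $G$ is metrically regular around $(\bar x,\bar z)$ with modulus $\mu\ge0$ if there are neighborhoods $U$ of $\bar x$ and $V$ of $\bar z$ such that $\operatorname{dist}(x;G^{-1}(z))\le\mu\operatorname{dist}(z;G(x))$ for all $x\in U$, $z\in V$. The exact regularity bound $\operatorname{reg}G(\bar x,\bar z)$ is the infimum of $\mu\ge 0$ over all $(\mu,U,V)$ for which this holds. For a convex set $C$ and $\bar w\in C$, $N_C(\bar w)=\{v : \langle v,w-\bar w\rangle\le 0\ \text{for all } w\in C\}$. *)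

theory Defs
  imports "HOL-Analysis.Analysis"
begin

text \<open>Point-to-set distance with values in \<open>[0, \<infinity>]\<close>; unlike \<^const>\<open>infdist\<close> it is
  \<open>\<infinity>\<close> for the empty set.\<close>

definition set_edist :: "'a::metric_space \<Rightarrow> 'a set \<Rightarrow> ennreal" where
  "set_edist x C = (INF c\<in>C. ennreal (dist x c))"

definition inverse_image_map :: "('a \<Rightarrow> 'b set) \<Rightarrow> 'b \<Rightarrow> 'a set" where
  "inverse_image_map G z = {x. z \<in> G x}"

definition metrically_regular_around ::
    "('a::metric_space \<Rightarrow> 'b::metric_space set) \<Rightarrow> 'a \<Rightarrow> 'b \<Rightarrow> real \<Rightarrow> bool" where
  "metrically_regular_around G xbar zbar \<mu> \<longleftrightarrow>
     zbar \<in> G xbar \<and> 0 \<le> \<mu> \<and>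
     (\<exists>U V. open U \<and> xbar \<in> U \<and> open V \<and> zbar \<in> V \<and>
        (\<forall>x\<in>U. \<forall>z\<in>V.
           set_edist x (inverse_image_map G z) \<le> ennreal \<mu> * set_edist z (G x)))"

definition exact_reg_bound ::
    "('a::metric_space \<Rightarrow> 'b::metric_space set) \<Rightarrow> 'a \<Rightarrow> 'b \<Rightarrow> ennreal" where
  "exact_reg_bound G xbar zbar =
     (INF \<mu>\<in>{\<mu>. metrically_regular_around G xbar zbar \<mu>}. ennreal \<mu>)"

definition subdifferential :: "('a::real_inner \<Rightarrow> real) \<Rightarrow> 'a \<Rightarrow> 'a set" where
  "subdifferential f w = {v. \<forall>w'. f w + v \<bullet> (w' - w) \<le> f w'}"

definition normal_cone :: "'a::real_inner set \<Rightarrow> 'a \<Rightarrow> 'a set" where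
  "normal_cone C w = {v. \<forall>w'\<in>C. v \<bullet> (w' - w) \<le> 0}"

definition prob_simplex :: "(real ^ 'k) set" where
  "prob_simplex = {x. (\<Sum>i\<in>UNIV. x $ i) = 1 \<and> (\<forall>i. 0 \<le> x $ i)}"

definition strategy_pairs :: "((real ^ 'm) \<times> (real ^ 'n)) set" where
  "strategy_pairs = prob_simplex \<times> prob_simplex"

text \<open>The supremum below is a maximum, see \<open>gap_attained\<close>.\<close>

definition gap :: "real ^ 'n ^ 'm \<Rightarrow> (real ^ 'm) \<times> (real ^ 'n) \<Rightarrow> real" where
  "gap A = (\<lambda>(x, y). SUP (u, v)\<in>strategy_pairs. x \<bullet> (A *v v) - u \<bullet> (A *v y))"

definition solution_set :: "real ^ 'n ^ 'm \<Rightarrow> ((real ^ 'm) \<times> (real ^ 'n)) set" where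
  "solution_set A = {w \<in> strategy_pairs. gap A w = 0}"

definition gap_map :: "real ^ 'n ^ 'm \<Rightarrow> (real ^ 'm) \<times> (real ^ 'n) \<Rightarrow> real set" where
  "gap_map A w = (if w \<in> strategy_pairs then {gap A w..} else {})"

lemma compact_prob_simplex: "compact (prob_simplex :: (real ^ 'k) set)"
proof -
  have "x $ i \<le> 1" if "x \<in> prob_simplex" for x :: "real ^ 'k" and i
  proof -
    have "x $ i \<le> (\<Sum>i\<in>UNIV. x $ i)"
      using that by (intro member_le_sum) (auto simp: prob_simplex_def)
    then show ?thesis using that by (simp add: prob_simplex_def)
  qed
  then have "prob_simplex \<subseteq> cbox (0 :: real ^ 'k) 1"
    by (auto simp: mem_box_cart prob_simplex_def)
  then have "bounded (prob_simplex :: (real ^ 'k) set)"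
    using bounded_cbox bounded_subset by blast
  moreover have "closed (prob_simplex :: (real ^ 'k) set)"
    unfolding prob_simplex_def
    by (intro closed_Collect_conj closed_Collect_eq closed_Collect_all closed_Collect_le
        continuous_intros)
  ultimately show ?thesis by (simp add: compact_eq_bounded_closed)
qed

lemma prob_simplex_nonempty: "(prob_simplex :: (real ^ 'k) set) \<noteq> {}"
proof -
  have "axis undefined 1 \<in> (prob_simplex :: (real ^ 'k) set)"
    by (auto simp: prob_simplex_def axis_def)
  then show ?thesis by blast
qed

lemma gap_attained:
  fixes A :: "real ^ 'n ^ 'm"
  obtains u v where "(u, v) \<in> strategy_pairs"
    and "gap A (x, y) = x \<bullet> (A *v v) - u \<bullet> (A *v y)"
    and "\<And>u' v'. (u', v') \<in> strategy_pairs \<Longrightarrow>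
           x \<bullet> (A *v v') - u' \<bullet> (A *v y) \<le> gap A (x, y)"
proof -
  let ?P = "strategy_pairs :: ((real ^ 'm) \<times> (real ^ 'n)) set"
  let ?h = "\<lambda>(u, v). x \<bullet> (A *v v) - u \<bullet> (A *v y)"
  have "compact ?P" "?P \<noteq> {}"
    by (auto simp: strategy_pairs_def compact_prob_simplex prob_simplex_nonempty
        intro!: compact_Times)
  moreover have "continuous_on ?P ?h"
    unfolding case_prod_beta
    by (intro continuous_intros matrix_vector_mult_linear_continuous_on
        continuous_on_compose2[of UNIV "(*v) A" _ snd]) auto
  ultimately obtain p where p: "p \<in> ?P" "\<And>q. q \<in> ?P \<Longrightarrow> ?h q \<le> ?h p"
    using continuous_attains_sup by metis
  have "gap A (x, y) = ?h p"
    unfolding gap_def prod.case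
    using p by (intro cSup_eq_maximum) auto
  then show thesis
    using that[of "fst p" "snd p"] p by (force simp: case_prod_beta)
qed

end

theory Submission
  imports Defs
begin

text \<open>
  The formula is one about any finite convex function \<open>f\<close> on a convex set \<open>C\<close>.
  A separation argument shows that \<open>\<partial>f(w) + N\<^sub>C(w)\<close> contains a vector of
  norm at most \<open>r\<close> iff \<open>f w - r \<parallel>u - w\<parallel> \<le> f u\<close> for all \<open>u \<in> C\<close>. So if the distance \<open>d\<close> from \<open>0\<close>
  to this set exceeds \<open>r\<close>, some \<open>u \<in> C\<close> violates the inequality, and by continuity the same \<open>u\<close>
  violates it at all points near \<open>w\<close>; walking from such a point straight towards \<open>u\<close> decreases
  \<open>f\<close> at rate at least \<open>r\<close>, which is regularity with modulus \<open>1/r\<close>. Conversely, regularity with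
  modulus \<open>\<mu>\<close> gives points \<open>u \<in> C\<close> where \<open>f\<close> has decreased at rate almost \<open>1/\<mu>\<close>, and the
  subgradient inequality bounds this rate by the norm of any element of the set.
\<close>

section \<open>Subgradients from separation\<close>

text \<open>Minimality of \<open>f + k\<close> at \<open>w\<close> over \<open>C\<close> says that
  the strict epigraph of \<open>f\<close> misses the region below the graph of
  \<open>f w + k w - k q\<close> over \<open>C\<close>. Both are convex, so a hyperplane separates
  them, and its slope is \<open>c\<close>. Thus \<open>c\<close> is a subgradient of
  \<open>f\<close>, and \<open>-c\<close> one of \<open>k\<close> relative to
  \<open>C\<close>.\<close>

lemma subgradient_sum_rule:
  fixes f k :: "'a::euclidean_space \<Rightarrow> real"
  assumes f: "convex_on UNIV f" and k: "convex_on C k" and w: "w \<in> C"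
    and min: "\<And>q. q \<in> C \<Longrightarrow> f w + k w \<le> f q + k q"
  obtains c where "c \<in> subdifferential f w"
    and "\<And>q. q \<in> C \<Longrightarrow> k w - c \<bullet> (q - w) \<le> k q"
proof -
  let ?S = "{(q, s). q \<in> C \<and> s \<le> f w + k w - k q}"
  let ?T = "{(p, t). f p < t}"
  have "convex C" using k convex_on_imp_convex by blast
  have "convex ?S"
  proof (rule convexI, clarsimp)
    fix q s q' s' and \<alpha> \<gamma> :: real
    assume *: "q \<in> C" "s \<le> f w + k w - k q" "q' \<in> C" "s' \<le> f w + k w - k q'"
      "0 \<le> \<alpha>" "0 \<le> \<gamma>" "\<alpha> + \<gamma> = 1"
    have "k (\<alpha> *\<^sub>R q + \<gamma> *\<^sub>R q') \<le> \<alpha> * k q + \<gamma> * k q'"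
      using k * by (simp add: convex_on_def)
    moreover have "\<alpha> * s + \<gamma> * s' \<le> \<alpha> * (f w + k w - k q) + \<gamma> * (f w + k w - k q')"
      using * by (intro add_mono mult_left_mono) auto
    moreover have "\<dots> = (\<alpha> + \<gamma>) * (f w + k w) - (\<alpha> * k q + \<gamma> * k q')"
      by (simp add: algebra_simps)
    ultimately show "\<alpha> *\<^sub>R q + \<gamma> *\<^sub>R q' \<in> C \<and>
        \<alpha> * s + \<gamma> * s' \<le> f w + k w - k (\<alpha> *\<^sub>R q + \<gamma> *\<^sub>R q')"
      using convexD[OF \<open>convex C\<close>] * by simp
  qed
  moreover have "convex ?T"
  proof (rule convexI, clarsimp)
    fix p t p' t' and \<alpha> \<gamma> :: real
    assume *: "f p < t" "f p' < t'" "0 \<le> \<alpha>" "0 \<le> \<gamma>" "\<alpha> + \<gamma> = 1"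
    have "f (\<alpha> *\<^sub>R p + \<gamma> *\<^sub>R p') \<le> \<alpha> * f p + \<gamma> * f p'"
      using f * by (simp add: convex_on_def)
    also have "\<dots> < \<alpha> * t + \<gamma> * t'"
    proof (cases "\<alpha> = 0")
      case False
      then show ?thesis using * by (intro add_less_le_mono mult_left_mono) auto
    qed (use * in auto)
    finally show "f (\<alpha> *\<^sub>R p + \<gamma> *\<^sub>R p') < \<alpha> * t + \<gamma> * t'" .
  qed
  moreover have "(w, f w) \<in> ?S" "(w, f w + 1) \<in> ?T" using w by auto
  moreover have "?S \<inter> ?T = {}" using min by force
  ultimately obtain a\<beta> b where sep: "a\<beta> \<noteq> 0" "\<forall>z\<in>?S. a\<beta> \<bullet> z \<le> b" "\<forall>z\<in>?T. b \<le> a\<beta> \<bullet> z"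
    using separating_hyperplane_sets[of ?S ?T] by blast
  obtain a \<beta> where a\<beta>: "a\<beta> = (a, \<beta>)" by (cases a\<beta>)
  have S: "a \<bullet> q + \<beta> * (f w + k w - k q) \<le> b" if "q \<in> C" for q
    using sep(2) that by (auto simp: a\<beta>)
  have T': "b \<le> a \<bullet> p + \<beta> * t" if "f p < t" for p t
    using sep(3) that by (auto simp: a\<beta>)
  have w_le: "a \<bullet> w + \<beta> * f w \<le> b" using S[OF w] by simp
  have "\<beta> \<ge> 0" using w_le T'[of w "f w + 1"] by (simp add: algebra_simps)
  \<comment> \<open>The hyperplane is not vertical: \<open>f\<close> is finite on the whole space,
    so the strict epigraph has points above \<open>w - a\<close>, and a vertical hyperplane would
    force \<open>a = 0\<close>.\<close>
  moreover have "\<beta> \<noteq> 0"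
  proof
    assume "\<beta> = 0"
    then have "a \<bullet> a \<le> 0"
      using w_le T'[of "w - a" "f (w - a) + 1"] by (simp add: inner_diff_right)
    then have "a = 0" by (metis inner_ge_zero inner_eq_zero_iff order_antisym)
    then show False using sep(1) \<open>\<beta> = 0\<close> by (simp add: a\<beta> zero_prod_def)
  qed
  ultimately have \<beta>: "\<beta> > 0" by simp
  have T: "b \<le> a \<bullet> p + \<beta> * f p" for p
  proof (rule field_le_epsilon)
    fix e :: real assume "e > 0"
    then show "b \<le> a \<bullet> p + \<beta> * f p + e"
      using T'[of p "f p + e / \<beta>"] \<beta> by (simp add: distrib_left)
  qed
  \<comment> \<open>Solving the hyperplane equation for the last coordinate gives an affine function
    with this gradient. It passes through \<open>(w, f w)\<close>, where both regions touch:
    \<open>w_le\<close> and \<open>T[of w]\<close> are the two inequalities.\<close>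
  define c where "c = - (1 / \<beta>) *\<^sub>R a"
  have c: "\<beta> * (c \<bullet> (p - w)) = a \<bullet> w - a \<bullet> p" for p
    using \<beta> by (simp add: c_def inner_diff_right right_diff_distrib)
  show thesis
  proof
    have "\<beta> * (f w + c \<bullet> (p - w)) \<le> \<beta> * f p" for p
      using T[of p] w_le by (simp add: distrib_left c)
    then show "c \<in> subdifferential f w"
      using \<beta> by (simp add: subdifferential_def)
    fix q assume "q \<in> C"
    then have "\<beta> * (k w - c \<bullet> (q - w)) \<le> \<beta> * k q"
      using S[of q] T[of w] by (simp add: right_diff_distrib distrib_left c)
    then show "k w - c \<bullet> (q - w) \<le> k q" using \<beta> by simp
  qed
qed

lemma convex_on_norm_diff:
  fixes w :: "'a::real_normed_vector"
  assumes "convex C" "0 \<le> r"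
  shows "convex_on C (\<lambda>p. r * norm (p - w))"
  using convex_on_cmul[OF assms(2) convex_on_dist[OF assms(1), of w]]
  by (simp add: dist_norm norm_minus_commute)

text \<open>By \<open>slope\<close>, \<open>w\<close> minimizes \<open>f + r * norm (_ - w)\<close>
  over \<open>C\<close>. The sum rule is used twice: first to split off a subgradient
  \<open>a\<close> of \<open>f\<close>, then to split off a subgradient \<open>e\<close> of the norm
  term from the linear function of slope \<open>a\<close> on \<open>C\<close>. What remains,
  \<open>- (a + e)\<close>, is normal to \<open>C\<close>, and \<open>v = - e\<close> is
  small.\<close>

lemma small_subgradient_plus_normal:
  fixes f :: "'a::euclidean_space \<Rightarrow> real"
  assumes f: "convex_on UNIV f" and C: "convex C" and w: "w \<in> C" and r: "0 \<le> r"
    and slope: "\<And>u. u \<in> C \<Longrightarrow> f w - r * norm (u - w) \<le> f u"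
  obtains v where "v \<in> subdifferential f w + normal_cone C w" "norm v \<le> r"
proof -
  obtain a where a: "a \<in> subdifferential f w"
    and aC: "\<And>q. q \<in> C \<Longrightarrow> - (a \<bullet> (q - w)) \<le> r * norm (q - w)"
    using subgradient_sum_rule[OF f convex_on_norm_diff[OF C r] w, of w] slope
    by (auto simp: algebra_simps)
  have lin: "convex_on C (\<lambda>q. a \<bullet> (q - w))"
    using C by (auto simp: convex_on_def algebra_simps simp flip: distrib_right)
  obtain e where e: "e \<in> subdifferential (\<lambda>p. r * norm (p - w)) w"
    and eC: "\<And>q. q \<in> C \<Longrightarrow> - (e \<bullet> (q - w)) \<le> a \<bullet> (q - w)"
    using subgradient_sum_rule[OF convex_on_norm_diff[OF convex_UNIV r] lin w, of w] aC
    by (auto simp: algebra_simps)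
  have "e \<bullet> (p - w) \<le> r * norm (p - w)" for p
    using e by (simp add: subdifferential_def)
  \<comment> \<open>Testing in the direction \<open>e\<close> itself bounds its norm by
    \<open>r\<close>.\<close>
  from this[of "w + e"] have "norm e * norm e \<le> r * norm e"
    by (simp add: norm_eq_sqrt_inner)
  then have "norm e \<le> r" using r by (cases "e = 0") auto
  moreover have "- (a + e) \<in> normal_cone C w"
    unfolding normal_cone_def
  proof (intro CollectI ballI)
    fix q assume "q \<in> C"
    from eC[OF this] show "- (a + e) \<bullet> (q - w) \<le> 0"
      by (simp only: inner_minus_left inner_add_left)
  qed
  then have "a + - (a + e) \<in> subdifferential f w + normal_cone C w"
    using a by (rule set_plus_intro[rotated])
  ultimately show thesis using that[of "- e"] by simp
qed

lemma subgradient_plus_normal_slope: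
  assumes "v \<in> subdifferential f w + normal_cone C w" "u \<in> C"
  shows "f w - norm v * norm (u - w) \<le> f u"
proof -
  obtain a b where v: "v = a + b" and a: "a \<in> subdifferential f w" and b: "b \<in> normal_cone C w"
    using assms(1) by (auto elim: set_plus_elim)
  have "f w + v \<bullet> (u - w) - b \<bullet> (u - w) \<le> f u"
    using a by (simp add: v subdifferential_def inner_add_left)
  moreover have "b \<bullet> (u - w) \<le> 0" using b assms(2) by (simp add: normal_cone_def)
  moreover have "- (norm v * norm (u - w)) \<le> v \<bullet> (u - w)"
    using Cauchy_Schwarz_ineq2[of v "u - w"] by linarith
  ultimately show ?thesis by linarith
qed

section \<open>Regularity of the restricted epigraphical map\<close>

text \<open>Its graph is the epigraph of \<open>f\<close> restricted to \<open>C\<close>;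
  \<open>gap_map A\<close> is the instance for \<open>gap A\<close> on
  \<open>strategy_pairs\<close>.\<close>

definition epi_map :: "('a \<Rightarrow> real) \<Rightarrow> 'a set \<Rightarrow> 'a \<Rightarrow> real set" where
  "epi_map f C w = (if w \<in> C then {f w..} else {})"

lemma inverse_image_epi_map: "inverse_image_map (epi_map f C) z = {u \<in> C. f u \<le> z}"
  by (auto simp: inverse_image_map_def epi_map_def)

lemma set_edist_le: "c \<in> C \<Longrightarrow> set_edist x C \<le> ennreal (dist x c)"
  unfolding set_edist_def by (rule INF_lower)

lemma set_edist_atLeast: "set_edist z {a..} = ennreal (max 0 (a - z))" for a z :: real
proof (rule antisym)
  show "set_edist z {a..} \<le> ennreal (max 0 (a - z))"
    using set_edist_le[of "max a z" "{a..}" z] by (cases "a \<le> z") (auto simp: dist_real_def)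
  show "ennreal (max 0 (a - z)) \<le> set_edist z {a..}"
    unfolding set_edist_def by (intro INF_greatest ennreal_leI) (auto simp: dist_real_def)
qed

lemma metrically_regular_epi_map:
  fixes f :: "'a::euclidean_space \<Rightarrow> real"
  assumes f: "convex_on UNIV f" and C: "convex C" and w: "w \<in> C" and r: "0 < r"
    and u: "u \<in> C" "f u < f w - r * norm (u - w)"
  shows "metrically_regular_around (epi_map f C) w (f w) (1 / r)"
proof -
  have cont: "continuous_on UNIV f" by (rule convex_on_continuous[OF open_UNIV f])
  \<comment> \<open>The strict inequality at \<open>w\<close> persists nearby because
    \<open>f\<close> is continuous, so one target \<open>u\<close> serves every \<open>p\<close> in
    \<open>U\<close>. The neighborhood of \<open>f w\<close> is \<open>{f u<..}\<close>.\<close>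
  define U where "U = {p. f u < f p - r * norm (u - p)}"
  have "set_edist p (inverse_image_map (epi_map f C) z)
      \<le> ennreal (1 / r) * set_edist z (epi_map f C p)"
    if p: "p \<in> U" and z: "f u < z" for p z
  proof (cases "p \<in> C")
    \<comment> \<open>Outside \<open>C\<close> the image is empty, so the right-hand side is a
      positive multiple of \<infinity>.\<close>
    case False
    then show ?thesis using r by (simp add: epi_map_def set_edist_def ennreal_mult_top)
  next
    case True
    show ?thesis
    proof (cases "f p \<le> z")
      case True
      then have "set_edist p (inverse_image_map (epi_map f C) z) \<le> ennreal (dist p p)"
        using \<open>p \<in> C\<close> by (intro set_edist_le) (simp add: inverse_image_epi_map)
      then show ?thesis by simp
    next
      case False
      \<comment> \<open>Here \<open>f u < z < f p\<close>, and \<open>t\<close> is where the linear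
        interpolation of \<open>f\<close> from \<open>p\<close> to \<open>u\<close> takes the value
        \<open>z\<close>. By convexity \<open>q\<close> then lies in the sublevel set for
        \<open>z\<close>.\<close>
      define t where "t = (f p - z) / (f p - f u)"
      have t: "0 \<le> t" "t \<le> 1" "t * (f p - f u) = f p - z"
        using False z by (auto simp: t_def)
      define q where "q = (1 - t) *\<^sub>R p + t *\<^sub>R u"
      have "f q \<le> (1 - t) * f p + t * f u"
        using f t by (auto simp: q_def convex_on_def)
      also have "\<dots> = z" using t(3) by (simp add: algebra_simps)
      finally have "f q \<le> z" .
      moreover have "q \<in> C"
        using C \<open>p \<in> C\<close> u(1) t unfolding q_def by (intro convexD) auto
      ultimately have "set_edist p (inverse_image_map (epi_map f C) z) \<le> ennreal (dist p q)"
        by (intro set_edist_le) (simp add: inverse_image_epi_map)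
      also have "dist p q = t * norm (u - p)"
      proof -
        have "q - p = t *\<^sub>R (u - p)" by (simp add: q_def algebra_simps)
        then show ?thesis using t(1) by (metis abs_of_nonneg dist_commute dist_norm norm_scaleR)
      qed
      also have "t * norm (u - p) \<le> 1 / r * (f p - z)"
      proof -
        have "t * (r * norm (u - p)) \<le> t * (f p - f u)"
          using p t(1) by (intro mult_left_mono) (auto simp: U_def)
        then show ?thesis using t(3) r by (simp add: field_simps)
      qed
      also have "ennreal (1 / r * (f p - z)) = ennreal (1 / r) * set_edist z (epi_map f C p)"
        using False \<open>p \<in> C\<close> r by (simp add: epi_map_def set_edist_atLeast flip: ennreal_mult)
      finally show ?thesis by (simp add: ennreal_leI)
    qed
  qed
  moreover have "open U"
    unfolding U_def by (intro open_Collect_less continuous_intros cont)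
  moreover have "w \<in> U" using u by (simp add: U_def)
  moreover have "f u < f w"
    using u(2) r by (smt (verit) mult_nonneg_nonneg norm_ge_zero)
  moreover have "f w \<in> epi_map f C w" using w by (simp add: epi_map_def)
  ultimately show ?thesis
    unfolding metrically_regular_around_def using r
    by (auto intro!: exI[of _ U] exI[of _ "{f u<..}"])
qed

text \<open>Regularity is used only at the base point \<open>w\<close> and at one level
  \<open>f w - h\<close> below it: a drop of \<open>h\<close> is reached within distance about
  \<open>\<mu> * h\<close>, while the subgradient inequality allows a drop of at most
  \<open>norm v\<close> per unit distance.\<close>

lemma metrically_regular_epi_map_lower:
  fixes f :: "'a::euclidean_space \<Rightarrow> real"
  assumes reg: "metrically_regular_around (epi_map f C) w (f w) \<mu>" and w: "w \<in> C"
    and v: "v \<in> subdifferential f w + normal_cone C w"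
  shows "1 \<le> norm v * \<mu>"
proof -
  have \<mu>: "0 \<le> \<mu>" using reg by (simp add: metrically_regular_around_def)
  obtain V where V: "open V" "f w \<in> V" and
    le: "\<And>z. z \<in> V \<Longrightarrow> set_edist w (inverse_image_map (epi_map f C) z)
        \<le> ennreal \<mu> * set_edist z (epi_map f C w)"
    using reg unfolding metrically_regular_around_def by blast
  obtain \<delta> where \<delta>: "\<delta> > 0" "ball (f w) \<delta> \<subseteq> V" using V open_contains_ball by blast
  define h where "h = \<delta> / 2"
  have h: "h > 0" "f w - h \<in> V" using \<delta> by (auto simp: h_def dist_real_def)
  \<comment> \<open>The infimum in \<open>set_edist\<close> need not be attained; enlarging the
    modulus by \<epsilon> makes the inequality strict and yields an actual point
    \<open>u\<close>.\<close>
  have bound: "1 \<le> norm v * (\<mu> + \<epsilon>)" if \<epsilon>: "\<epsilon> > 0" for \<epsilon>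
  proof -
    have "set_edist w (inverse_image_map (epi_map f C) (f w - h)) \<le> ennreal (\<mu> * h)"
      using le[OF h(2)] w h(1) \<mu> by (simp add: epi_map_def set_edist_atLeast ennreal_mult)
    also have "\<dots> < ennreal ((\<mu> + \<epsilon>) * h)"
      using h(1) \<epsilon> \<mu> by (intro ennreal_lessI) auto
    finally obtain u where u: "u \<in> C" "f u \<le> f w - h"
      and "ennreal (dist w u) < ennreal ((\<mu> + \<epsilon>) * h)"
      unfolding set_edist_def inverse_image_epi_map INF_less_iff by auto
    then have "norm (u - w) \<le> (\<mu> + \<epsilon>) * h"
      using \<mu> \<epsilon> h(1) by (simp add: ennreal_less_iff dist_norm norm_minus_commute)
    then have "norm v * norm (u - w) \<le> norm v * ((\<mu> + \<epsilon>) * h)"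
      by (intro mult_left_mono) auto
    then have "h * 1 \<le> h * (norm v * (\<mu> + \<epsilon>))"
      using subgradient_plus_normal_slope[OF v u(1)] u(2) by (simp add: algebra_simps)
    then show ?thesis using h(1) mult_le_cancel_left_pos by blast
  qed
  show ?thesis
  proof (rule field_le_epsilon)
    fix e :: real assume e: "e > 0"
    have "norm v \<noteq> 0" using bound[of 1] by auto
    then show "1 \<le> norm v * \<mu> + e"
      using bound[of "e / norm v"] e by (simp add: distrib_left)
  qed
qed

text \<open>Since 0 and \<infinity> are inverse to each other in \<open>ennreal\<close>, inversion
  is an involution; with antitonicity it transfers bounds between the regularity bound and the
  distance, extreme values included.\<close>

lemma ennreal_inverse_inverse: "inverse (inverse a) = a" for a :: ennreal
proof (cases a)
  case (real r)
  then show ?thesis by (cases "r = 0") (auto simp: inverse_ennreal)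
qed auto

lemma ennreal_inverse_antimono: "a \<le> b \<Longrightarrow> inverse b \<le> inverse a" for a b :: ennreal
proof (cases a; cases b)
  fix r t assume "a \<le> b" "0 \<le> r" "a = ennreal r" "0 \<le> t" "b = ennreal t"
  then show ?thesis
    by (cases "r = 0") (auto simp: inverse_ennreal le_imp_inverse_le intro!: ennreal_leI)
qed (auto simp: top_unique)

theorem exact_reg_bound_epi_map:
  fixes f :: "'a::euclidean_space \<Rightarrow> real"
  assumes f: "convex_on UNIV f" and C: "convex C" and w: "w \<in> C"
  shows "exact_reg_bound (epi_map f C) w (f w) =
    1 / set_edist 0 (subdifferential f w + normal_cone C w)"
    (is "?reg = 1 / set_edist 0 ?K")
proof (rule antisym)
  show "?reg \<le> 1 / set_edist 0 ?K"
  proof (rule ccontr)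
    assume "\<not> ?thesis"
    then have "inverse (set_edist 0 ?K) < ?reg" by (simp add: divide_ennreal_def)
    then have "inverse ?reg < set_edist 0 ?K"
      by (metis ennreal_inverse_antimono ennreal_inverse_inverse not_le)
    \<comment> \<open>Any slope strictly between the two is finite and positive. Being below the
      distance, it is violated at some \<open>u\<close>, which gives regularity with modulus
      \<open>1 / r\<close>, too small for \<open>?reg\<close>.\<close>
    then obtain s where s: "inverse ?reg < s" "s < set_edist 0 ?K"
      using dense by blast
    then obtain r where r: "s = ennreal r" "0 \<le> r"
      by (cases s) auto
    have r0: "0 < r" using s(1) r by (metis ennreal_0 not_less_zero order_le_less)
    obtain u where u: "u \<in> C" "f u < f w - r * norm (u - w)"
    proof (rule ccontr)
      assume "\<not> thesis"
      then have "f w - r * norm (u - w) \<le> f u" if "u \<in> C" for u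
        using \<open>\<And>u. u \<in> C \<Longrightarrow> f u < f w - r * norm (u - w) \<Longrightarrow> thesis\<close> that by force
      then obtain v where "v \<in> ?K" "norm v \<le> r"
        using small_subgradient_plus_normal[OF f C w r(2)] by blast
      then have "set_edist 0 ?K \<le> ennreal r"
        using set_edist_le[of v ?K 0] by (simp add: order_trans[OF _ ennreal_leI])
      then show False using s(2) r(1) by simp
    qed
    have "?reg \<le> ennreal (1 / r)"
      unfolding exact_reg_bound_def
      using metrically_regular_epi_map[OF f C w r0 u] by (intro INF_lower) simp
    also have "\<dots> = inverse s" using r r0 by (simp add: inverse_ennreal inverse_eq_divide)
    finally have "inverse (inverse s) \<le> inverse ?reg" by (rule ennreal_inverse_antimono)
    then show False using s(1) by (simp add: ennreal_inverse_inverse)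
  qed
  show "1 / set_edist 0 ?K \<le> ?reg"
    unfolding exact_reg_bound_def
  proof (rule INF_greatest, clarify)
    fix \<mu> assume reg: "metrically_regular_around (epi_map f C) w (f w) \<mu>"
    then have \<mu>0: "0 \<le> \<mu>" by (simp add: metrically_regular_around_def)
    show "1 / set_edist 0 ?K \<le> ennreal \<mu>"
    proof (cases "\<mu> = 0")
      \<comment> \<open>Modulus 0 would give \<open>1 \<le> 0\<close> for any element of
        \<open>?K\<close>; hence \<open>?K\<close> is empty, its distance is \<infinity>, and the
        reciprocal is 0.\<close>
      case True
      then have "?K = {}" using metrically_regular_epi_map_lower[OF reg w] by force
      then show ?thesis by (simp add: set_edist_def)
    next
      case False
      then have \<mu>: "0 < \<mu>" using \<mu>0 by simp
      have "ennreal (1 / \<mu>) \<le> set_edist 0 ?K"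
        unfolding set_edist_def
        using metrically_regular_epi_map_lower[OF reg w] \<mu>
        by (intro INF_greatest ennreal_leI) (simp add: field_simps)
      then have "inverse (set_edist 0 ?K) \<le> inverse (ennreal (1 / \<mu>))"
        by (rule ennreal_inverse_antimono)
      then show ?thesis using \<mu> by (simp add: divide_ennreal_def inverse_ennreal)
    qed
  qed
qed

section \<open>The duality gap\<close>

lemma convex_prob_simplex: "convex prob_simplex"
  by (rule convexI) (auto simp: prob_simplex_def sum.distrib simp flip: sum_distrib_left)

lemma convex_strategy_pairs: "convex strategy_pairs"
  unfolding strategy_pairs_def by (intro convex_Times convex_prob_simplex)

text \<open>For fixed \<open>(u, v)\<close> the payoff difference is linear in
  \<open>(x, y)\<close>, so the gap is a maximum of linear functions. The maximizer at the combined
  point is a competitor at both endpoints.\<close>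

lemma convex_on_gap: "convex_on UNIV (gap A)" for A :: "real ^ 'n ^ 'm"
proof -
  have "gap A (s *\<^sub>R (x, y) + t *\<^sub>R (x', y')) \<le> s * gap A (x, y) + t * gap A (x', y')"
    if st: "0 \<le> s" "0 \<le> t" for s t x y x' y'
  proof -
    have le: "p \<bullet> (A *v v) - u \<bullet> (A *v q) \<le> gap A (p, q)"
      if "(u, v) \<in> strategy_pairs" for p q u v
      using gap_attained[of A p q] that by metis
    obtain u v where uv: "(u, v) \<in> strategy_pairs"
      and eq: "gap A (s *\<^sub>R x + t *\<^sub>R x', s *\<^sub>R y + t *\<^sub>R y') =
        (s *\<^sub>R x + t *\<^sub>R x') \<bullet> (A *v v) - u \<bullet> (A *v (s *\<^sub>R y + t *\<^sub>R y'))"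
      using gap_attained[of A "s *\<^sub>R x + t *\<^sub>R x'" "s *\<^sub>R y + t *\<^sub>R y'"] by metis
    have "gap A (s *\<^sub>R x + t *\<^sub>R x', s *\<^sub>R y + t *\<^sub>R y') =
        s * (x \<bullet> (A *v v) - u \<bullet> (A *v y)) + t * (x' \<bullet> (A *v v) - u \<bullet> (A *v y'))"
      unfolding eq by (simp add: algebra_simps)
    also have "\<dots> \<le> s * gap A (x, y) + t * gap A (x', y')"
      using st le[OF uv] by (intro add_mono mult_left_mono) auto
    finally show ?thesis by simp
  qed
  then show ?thesis by (auto simp: convex_on_def)
qed

theorem theorem1p2:
  fixes A :: "real ^ 'n ^ 'm" and x :: "real ^ 'm" and y :: "real ^ 'n"
  assumes "(x, y) \<in> strategy_pairs - solution_set A"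
  shows "exact_reg_bound (gap_map A) (x, y) (gap A (x, y)) =
    1 / set_edist 0 (subdifferential (gap A) (x, y) + normal_cone strategy_pairs (x, y))"
proof -
  have gap_map: "gap_map A = epi_map (gap A) strategy_pairs"
    by (auto simp: gap_map_def epi_map_def)
  show ?thesis
    unfolding gap_map
    using assms by (intro exact_reg_bound_epi_map convex_on_gap convex_strategy_pairs) simp
qed

end
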